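(* Let $\mathcal{G}$ be an undirected connected graph without loops on $C=\{1,\dots,L\}$ and let $k\ge 1$ be an integer. Then the fixed points of $N^k$ are in one-to-one correspondence with the $k$-minimal transversals of the hypergraph $\mathcal{H}(k)$, and so are the fixed points of $F^k$.
   Context: For $i\in C$ let $S(i)$ be the set of neighbours of $i$ in $\mathcal{G}$. $\mathbb{B}=\{0,1\}$. Define $F^k\colon\mathbb{B}^{2L}\to\mathbb{B}^{2L}$, writing states as $(n,d)=(n_1,\dots,n_L,d_1,\dots,d_L)$, by $F^k_i(n,d)=1$ iff $\sum_{j\in S(i)}d_j\ge k$, and $F^k_{i+L}(n,d)=1-n_i$, for $i\in C$. Define $N^k\colon\mathbb{B}^L\to\mathbb{B}^L$ by $N^k_i(n)=1$ iff $\sum_{j\in S(i)}(1-n_j)\ge k$. A fixed point of a map $f$ is $x$ with $f(x)=x$. The hypergraph $\mathcal{H}(k)$ has vertex set $C$ and edge set $\{\{i\}\cup H : i\in C,\ H\subseteq S(i),\ |H|=k\}$. A transversal of $\mathcal{H}(k)$ is a set $Q\subseteq C$ meeting every edge. A transversal $Q$ is $k$-minimal if $|S(i)\cap Q|\le |S(i)|-k$ for every $i\in Q$. *)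

theory Defs
  imports "Graph_Theory.Graph_Theory" "HOL-Library.FuncSet"
begin

text \<open>
  An undirected graph is a symmetric set of pairs of vertices (locale \<open>pair_graph\<close>, which also
  excludes loops).
\<close>

definition neighbours :: "nat pair_pre_digraph \<Rightarrow> nat \<Rightarrow> nat set" where
  "neighbours G i = {j \<in> pverts G. (i, j) \<in> parcs G}"

text \<open>
  A point of \<open>\<bool>\<^sup>m\<close> is a function on \<open>{1..m}\<close> with values in \<open>{0, 1}\<close>, extended by
  \<open>undefined\<close> outside \<open>{1..m}\<close> so that equality of points is equality of functions.
\<close>

definition bool_cube :: "nat \<Rightarrow> (nat \<Rightarrow> nat) set" where
  "bool_cube m = {1..m} \<rightarrow>\<^sub>E {0, 1}"

definition fixed_points :: "(nat \<Rightarrow> nat) set \<Rightarrow> ((nat \<Rightarrow> nat) \<Rightarrow> (nat \<Rightarrow> nat)) \<Rightarrow> (nat \<Rightarrow> nat) set" where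
  "fixed_points X f = {x \<in> X. f x = x}"

definition N_map :: "nat \<Rightarrow> nat pair_pre_digraph \<Rightarrow> nat \<Rightarrow> (nat \<Rightarrow> nat) \<Rightarrow> (nat \<Rightarrow> nat)" where
  "N_map L G k n =
     (\<lambda>i\<in>{1..L}. if (\<Sum>j\<in>neighbours G i. 1 - n j) \<ge> k then 1 else 0)"

text \<open>A state \<open>x = (n, d)\<close> of \<open>\<bool>\<^sup>2\<^sup>L\<close> has \<open>n\<^sub>i = x i\<close> and \<open>d\<^sub>i = x (i + L)\<close> for \<open>i \<in> {1..L}\<close>.\<close>

definition F_map :: "nat \<Rightarrow> nat pair_pre_digraph \<Rightarrow> nat \<Rightarrow> (nat \<Rightarrow> nat) \<Rightarrow> (nat \<Rightarrow> nat)" where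
  "F_map L G k x =
     (\<lambda>m\<in>{1..2 * L}.
        if m \<le> L then (if (\<Sum>j\<in>neighbours G m. x (j + L)) \<ge> k then 1 else 0)
        else 1 - x (m - L))"

lemma N_map_bool_cube: "N_map L G k n \<in> bool_cube L"
  by (auto simp: N_map_def bool_cube_def)

lemma F_map_bool_cube: "x \<in> bool_cube (2 * L) \<Longrightarrow> F_map L G k x \<in> bool_cube (2 * L)"
  by (auto simp: F_map_def bool_cube_def)

text \<open>A hypergraph is a pair of its vertex set and its edge set.\<close>

definition neighbour_hypergraph :: "nat pair_pre_digraph \<Rightarrow> nat \<Rightarrow> nat set \<times> nat set set" where
  "neighbour_hypergraph G k =
     (pverts G, {{i} \<union> H | i H. i \<in> pverts G \<and> H \<subseteq> neighbours G i \<and> card H = k})"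

definition transversal :: "nat set \<times> nat set set \<Rightarrow> nat set \<Rightarrow> bool" where
  "transversal \<H> Q \<longleftrightarrow> Q \<subseteq> fst \<H> \<and> (\<forall>e \<in> snd \<H>. Q \<inter> e \<noteq> {})"

text \<open>The difference is taken in \<open>int\<close>: it is negative when \<open>i\<close> has fewer than \<open>k\<close> neighbours.\<close>

definition k_minimal :: "nat pair_pre_digraph \<Rightarrow> nat \<Rightarrow> nat set \<Rightarrow> bool" where
  "k_minimal G k Q \<longleftrightarrow>
     (\<forall>i \<in> Q. int (card (neighbours G i \<inter> Q)) \<le> int (card (neighbours G i)) - int k)"

definition k_minimal_transversals :: "nat pair_pre_digraph \<Rightarrow> nat \<Rightarrow> nat set set" where
  "k_minimal_transversals G k =
     {Q. transversal (neighbour_hypergraph G k) Q \<and> k_minimal G k Q}"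

end

theory Submission
  imports Defs
begin

text \<open>
  A set \<open>Q\<close> of vertices is a transversal iff every \<open>i \<notin> Q\<close> has fewer than \<open>k\<close> neighbours outside
  \<open>Q\<close>, and it is \<open>k\<close>-minimal iff every \<open>i \<in> Q\<close> has at least \<open>k\<close> neighbours outside \<open>Q\<close>. Together
  these say that the indicator function of \<open>Q\<close> is fixed by \<open>N\<^sup>k\<close>. A fixed point \<open>(n, d)\<close> of
  \<open>F\<^sup>k\<close> satisfies \<open>d = 1 - n\<close>, which turns the remaining equations into \<open>N\<^sup>k n = n\<close>.
\<close>

lemma neighbours_subset: "neighbours G i \<subseteq> pverts G"
  by (auto simp: neighbours_def)

text \<open>An edge \<open>{i} \<union> H\<close> avoids \<open>Q\<close> iff
  \<open>i \<notin> Q\<close> and \<open>H\<close> is a \<open>k\<close>-element subset of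
  \<open>neighbours G i - Q\<close>; in a finite graph such an \<open>H\<close> exists iff that set
  has at least \<open>k\<close> elements.\<close>

lemma transversal_neighbour_hypergraph_iff:
  assumes "finite (pverts G)"
  shows "transversal (neighbour_hypergraph G k) Q \<longleftrightarrow>
    Q \<subseteq> pverts G \<and> (\<forall>i \<in> pverts G - Q. card (neighbours G i - Q) < k)"
proof -
  have fin: "finite (neighbours G i - Q)" for i
    using assms finite_subset[OF neighbours_subset] by blast
  have few_iff: "(\<forall>H. H \<subseteq> neighbours G i \<and> card H = k \<longrightarrow> Q \<inter> ({i} \<union> H) \<noteq> {}) \<longleftrightarrow>
      card (neighbours G i - Q) < k" if "i \<notin> Q" for i
  proof
    assume meets: "\<forall>H. H \<subseteq> neighbours G i \<and> card H = k \<longrightarrow> Q \<inter> ({i} \<union> H) \<noteq> {}"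
    show "card (neighbours G i - Q) < k"
    proof (rule ccontr)
      assume "\<not> card (neighbours G i - Q) < k"
      then obtain H where "H \<subseteq> neighbours G i - Q" "card H = k"
        by (meson not_less obtain_subset_with_card_n)
      then show False
        using meets \<open>i \<notin> Q\<close> by blast
    qed
  next
    assume few: "card (neighbours G i - Q) < k"
    show "\<forall>H. H \<subseteq> neighbours G i \<and> card H = k \<longrightarrow> Q \<inter> ({i} \<union> H) \<noteq> {}"
    proof (intro allI impI notI)
      fix H
      assume H: "H \<subseteq> neighbours G i \<and> card H = k" and "Q \<inter> ({i} \<union> H) = {}"
      then have "H \<subseteq> neighbours G i - Q"
        by blast
      from card_mono[OF fin this] show False
        using H few by simp
    qed
  qed
  \<comment> \<open>For \<open>i \<in> Q\<close> every edge \<open>{i} \<union> H\<close> is met at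
    \<open>i\<close> itself, so only \<open>i\<close> outside \<open>Q\<close> give a
    condition.\<close>
  have "transversal (neighbour_hypergraph G k) Q \<longleftrightarrow> Q \<subseteq> pverts G \<and> (\<forall>i \<in> pverts G - Q.
      \<forall>H. H \<subseteq> neighbours G i \<and> card H = k \<longrightarrow> Q \<inter> ({i} \<union> H) \<noteq> {})"
    unfolding transversal_def neighbour_hypergraph_def fst_conv snd_conv by blast
  then show ?thesis
    using few_iff by simp
qed

text \<open>Subtract the neighbours inside \<open>Q\<close> from all neighbours. Integer subtraction
  keeps this valid when \<open>i\<close> has fewer than \<open>k\<close> neighbours.\<close>

lemma k_minimal_iff:
  assumes "finite (pverts G)"
  shows "k_minimal G k Q \<longleftrightarrow> (\<forall>i \<in> Q. k \<le> card (neighbours G i - Q))"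
proof -
  have "card (neighbours G i) = card (neighbours G i \<inter> Q) + card (neighbours G i - Q)" for i
    using assms finite_subset[OF neighbours_subset] by (metis card_Int_Diff)
  then show ?thesis
    by (simp add: k_minimal_def)
qed

text \<open>The two conditions are the two directions of one equivalence, which at each vertex is
  the fixed point equation of \<open>N_map\<close> for the indicator function of
  \<open>Q\<close>.\<close>

lemma k_minimal_transversals_iff:
  assumes "finite (pverts G)"
  shows "Q \<in> k_minimal_transversals G k \<longleftrightarrow>
    Q \<subseteq> pverts G \<and> (\<forall>i \<in> pverts G. i \<in> Q \<longleftrightarrow> k \<le> card (neighbours G i - Q))"
  unfolding k_minimal_transversals_def mem_Collect_eq
    transversal_neighbour_hypergraph_iff[OF assms] k_minimal_iff[OF assms] not_le[symmetric]
  by blast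

lemma bij_betw_bool_cube_support:
  "bij_betw (\<lambda>n. {i \<in> {1..L}. n i = 1}) (bool_cube L) (Pow {1..L})"
proof (rule bij_betw_byWitness[where f' = "\<lambda>Q. \<lambda>i\<in>{1..L}. if i \<in> Q then 1 else 0"])
  show "\<forall>n \<in> bool_cube L. (\<lambda>i\<in>{1..L}. if i \<in> {i \<in> {1..L}. n i = 1} then 1 else 0) = n"
    by (force simp: bool_cube_def PiE_iff extensional_def fun_eq_iff)
qed (auto simp: bool_cube_def split: if_splits)

text \<open>On 0-1 values the summand is the indicator of \<open>n j \<noteq> 1\<close>, so the sum
  counts the elements of \<open>A\<close> outside the support of \<open>n\<close>.\<close>

lemma sum_complement_eq_card:
  fixes n :: "nat \<Rightarrow> nat"
  assumes "n \<in> bool_cube L" and "A \<subseteq> {1..L}"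
  shows "(\<Sum>j\<in>A. 1 - n j) = card (A - {i \<in> {1..L}. n i = 1})"
proof -
  have "(\<Sum>j\<in>A. 1 - n j) = (\<Sum>j\<in>A. if n j \<noteq> 1 then 1 else 0)"
    using assms by (intro sum.cong) (fastforce simp: bool_cube_def PiE_iff)+
  also have "\<dots> = card {j \<in> A. n j \<noteq> 1}"
    using finite_subset[OF assms(2)] by (simp add: sum.If_cases Int_def)
  also have "{j \<in> A. n j \<noteq> 1} = A - {i \<in> {1..L}. n i = 1}"
    using assms(2) by auto
  finally show ?thesis .
qed

lemma N_map_fixed_iff:
  assumes "pverts G = {1..L}" and n: "n \<in> bool_cube L"
  shows "N_map L G k n = n \<longleftrightarrow> {i \<in> {1..L}. n i = 1} \<in> k_minimal_transversals G k"
proof -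
  let ?Q = "{i \<in> {1..L}. n i = 1}"
  \<comment> \<open>Both functions lie in the cube and are \<open>undefined\<close> off
    \<open>{1..L}\<close>, so comparing them there suffices.\<close>
  have "N_map L G k n = n \<longleftrightarrow> (\<forall>i \<in> {1..L}. N_map L G k n i = n i)"
    using N_map_bool_cube[of L G k n] n unfolding bool_cube_def by (metis PiE_ext)
  also have "\<dots> \<longleftrightarrow> (\<forall>i \<in> {1..L}. i \<in> ?Q \<longleftrightarrow> k \<le> card (neighbours G i - ?Q))"
  proof (intro ball_cong refl)
    fix i assume i: "i \<in> {1..L}"
    have "n i = 0 \<or> n i = 1"
      using n i by (auto simp: bool_cube_def PiE_iff)
    moreover have "(\<Sum>j\<in>neighbours G i. 1 - n j) = card (neighbours G i - ?Q)"
      using sum_complement_eq_card[OF n] neighbours_subset assms(1) by metis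
    ultimately show "N_map L G k n i = n i \<longleftrightarrow> (i \<in> ?Q \<longleftrightarrow> k \<le> card (neighbours G i - ?Q))"
      using i by (auto simp: N_map_def)
  qed
  also have "\<dots> \<longleftrightarrow> ?Q \<in> k_minimal_transversals G k"
    using k_minimal_transversals_iff[of G ?Q k] assms(1) by auto
  finally show ?thesis .
qed

lemma bij_betw_N_map_fixed_points:
  assumes "pverts G = {1..L}"
  shows "bij_betw (\<lambda>n. {i \<in> {1..L}. n i = 1})
    (fixed_points (bool_cube L) (N_map L G k)) (k_minimal_transversals G k)"
proof (rule bij_betw_subset[OF bij_betw_bool_cube_support])
  let ?supp = "\<lambda>n :: nat \<Rightarrow> nat. {i \<in> {1..L}. n i = 1}"
  \<comment> \<open>Surjectivity: a transversal consists of vertices, hence is the support of some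
    point of the cube, and that point is fixed by \<open>N_map_fixed_iff\<close>.\<close>
  have "k_minimal_transversals G k \<subseteq> ?supp ` bool_cube L"
    using k_minimal_transversals_iff[of G _ k] assms bij_betw_bool_cube_support[of L]
    by (auto simp: bij_betw_def)
  then show "?supp ` fixed_points (bool_cube L) (N_map L G k) = k_minimal_transversals G k"
    using N_map_fixed_iff[OF assms, of _ k] unfolding fixed_points_def by fast
qed (auto simp: fixed_points_def)

lemma F_map_fixed_iff:
  assumes "pverts G = {1..L}" and x: "x \<in> bool_cube (2 * L)"
  shows "F_map L G k x = x \<longleftrightarrow>
    N_map L G k (restrict x {1..L}) = restrict x {1..L} \<and> (\<forall>i \<in> {1..L}. x (i + L) = 1 - x i)"
proof -
  have split: "{1..2 * L} = {1..L} \<union> (\<lambda>i. i + L) ` {1..L}"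
    by (auto simp: image_add_atLeastAtMost)
  have "F_map L G k x = x \<longleftrightarrow> (\<forall>m \<in> {1..2 * L}. F_map L G k x m = x m)"
    using F_map_bool_cube[OF x] x unfolding bool_cube_def by (metis PiE_ext)
  also have "\<dots> \<longleftrightarrow>
      (\<forall>i \<in> {1..L}. F_map L G k x i = x i) \<and> (\<forall>i \<in> {1..L}. x (i + L) = 1 - x i)"
    \<comment> \<open>Since \<open>i \<ge> 1\<close>, the index \<open>i + L\<close> exceeds
      \<open>L\<close> and falls into the second branch of \<open>F_map\<close>.\<close>
    unfolding split ball_Un ball_simps by (auto simp: F_map_def)
  finally have "F_map L G k x = x \<longleftrightarrow>
      (\<forall>i \<in> {1..L}. F_map L G k x i = x i) \<and> (\<forall>i \<in> {1..L}. x (i + L) = 1 - x i)" .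
  \<comment> \<open>Once \<open>d = 1 - n\<close> is known, the threshold sums of
    \<open>F_map\<close> and \<open>N_map\<close> agree term by term.\<close>
  moreover have "(\<forall>i \<in> {1..L}. F_map L G k x i = x i) \<longleftrightarrow>
      N_map L G k (restrict x {1..L}) = restrict x {1..L}"
    if d: "\<forall>i \<in> {1..L}. x (i + L) = 1 - x i"
  proof -
    have "(\<Sum>j\<in>neighbours G i. 1 - restrict x {1..L} j) = (\<Sum>j\<in>neighbours G i. x (j + L))" for i
      using d neighbours_subset[of G i] assms(1) by (intro sum.cong) auto
    then have "F_map L G k x i = N_map L G k (restrict x {1..L}) i" if "i \<in> {1..L}" for i
      using that by (simp add: F_map_def N_map_def)
    moreover have "N_map L G k (restrict x {1..L}) = restrict x {1..L} \<longleftrightarrow>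
        (\<forall>i \<in> {1..L}. N_map L G k (restrict x {1..L}) i = x i)"
    proof
      assume "N_map L G k (restrict x {1..L}) = restrict x {1..L}"
      then show "\<forall>i \<in> {1..L}. N_map L G k (restrict x {1..L}) i = x i"
        by simp
    next
      assume "\<forall>i \<in> {1..L}. N_map L G k (restrict x {1..L}) i = x i"
      then show "N_map L G k (restrict x {1..L}) = restrict x {1..L}"
        by (intro extensionalityI[of _ "{1..L}"]) (simp_all add: N_map_def)
    qed
    ultimately show "(\<forall>i \<in> {1..L}. F_map L G k x i = x i) \<longleftrightarrow>
        N_map L G k (restrict x {1..L}) = restrict x {1..L}"
      by simp
  qed
  ultimately show ?thesis
    by blast
qed

text \<open>Dropping the second half of a fixed state loses nothing, because
  \<open>d = 1 - n\<close> recovers it.\<close>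

lemma bij_betw_F_map_N_map_fixed_points:
  assumes "pverts G = {1..L}"
  shows "bij_betw (\<lambda>x. restrict x {1..L})
    (fixed_points (bool_cube (2 * L)) (F_map L G k)) (fixed_points (bool_cube L) (N_map L G k))"
proof -
  \<comment> \<open>The inverse of the restriction: \<open>ext n\<close> is the state
    \<open>(n, 1 - n)\<close>.\<close>
  define ext :: "(nat \<Rightarrow> nat) \<Rightarrow> nat \<Rightarrow> nat" where
    "ext n = (\<lambda>m\<in>{1..2 * L}. if m \<le> L then n m else 1 - n (m - L))" for n
  have ext_cube: "ext n \<in> bool_cube (2 * L)" if "n \<in> bool_cube L" for n
    using that by (auto simp: ext_def bool_cube_def PiE_iff)
  have restrict_ext: "restrict (ext n) {1..L} = n" if "n \<in> bool_cube L" for n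
    using that by (auto simp: ext_def bool_cube_def PiE_iff extensional_def fun_eq_iff)
  have ext_restrict: "ext (restrict x {1..L}) = x"
    if x: "x \<in> bool_cube (2 * L)" and d: "\<forall>i \<in> {1..L}. x (i + L) = 1 - x i" for x
  proof
    fix m
    show "ext (restrict x {1..L}) m = x m"
    proof (cases "m \<in> {1..2 * L} \<and> \<not> m \<le> L")
      case True
      then show ?thesis
        using d[rule_format, of "m - L"] by (auto simp: ext_def)
    next
      case False
      then show ?thesis
        using x by (auto simp: ext_def bool_cube_def PiE_iff extensional_def)
    qed
  qed
  show ?thesis
  proof (rule bij_betw_byWitness[where f' = ext])
    show "\<forall>x \<in> fixed_points (bool_cube (2 * L)) (F_map L G k). ext (restrict x {1..L}) = x"
      using F_map_fixed_iff[OF assms] ext_restrict by (auto simp: fixed_points_def)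
    show "\<forall>n \<in> fixed_points (bool_cube L) (N_map L G k). restrict (ext n) {1..L} = n"
      using restrict_ext by (auto simp: fixed_points_def)
    show "(\<lambda>x. restrict x {1..L}) ` fixed_points (bool_cube (2 * L)) (F_map L G k)
        \<subseteq> fixed_points (bool_cube L) (N_map L G k)"
      using F_map_fixed_iff[OF assms] N_map_bool_cube
      by (auto simp: fixed_points_def) metis
    show "ext ` fixed_points (bool_cube L) (N_map L G k)
        \<subseteq> fixed_points (bool_cube (2 * L)) (F_map L G k)"
      using F_map_fixed_iff[OF assms ext_cube] ext_cube restrict_ext
      by (auto simp: fixed_points_def) (auto simp: ext_def)
  qed
qed

theorem theorem11:
  fixes G :: "nat pair_pre_digraph" and L k :: nat
  assumes "pair_graph G"
    and "pverts G = {1..L}"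
    and "connected (with_proj G)"
    and "k \<ge> 1"
  shows "bij_betw (\<lambda>n. {i \<in> {1..L}. n i = 1})
           (fixed_points (bool_cube L) (N_map L G k)) (k_minimal_transversals G k) \<and>
         bij_betw (\<lambda>x. {i \<in> {1..L}. x i = 1})
           (fixed_points (bool_cube (2 * L)) (F_map L G k)) (k_minimal_transversals G k)"
proof -
  \<comment> \<open>The support reads only coordinates in \<open>{1..L}\<close>, so restricting
    first does not change it; the second bijection is thus a composition of the two already
    found.\<close>
  have "(\<lambda>n. {i \<in> {1..L}. n i = 1}) \<circ> (\<lambda>x. restrict x {1..L}) =
      (\<lambda>x :: nat \<Rightarrow> nat. {i \<in> {1..L}. x i = 1})"
    by (auto simp: fun_eq_iff)
  then show ?thesis
    using bij_betw_N_map_fixed_points[OF assms(2)]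
      bij_betw_trans[OF bij_betw_F_map_N_map_fixed_points[OF assms(2)]
        bij_betw_N_map_fixed_points[OF assms(2)], of k]
    by simp
qed

end
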